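(* Any nontrivial $2$-dimensional Jordan algebra over $\mathbb{R}$ is isomorphic to one and only one of the following real algebras, given by their matrices of structure constants (different values of a parameter count as different algebras in the list): $$J_{1,r}=\begin{pmatrix}\frac12&0&0&1\\0&\frac12&\frac12&0\end{pmatrix},\qquad J_{2,r}=\begin{pmatrix}\frac12&0&0&1\\0&-\frac12&\frac12&0\end{pmatrix},$$ $$J_{3,r}=\begin{pmatrix}\frac12&0&0&-1\\0&\frac12&\frac12&0\end{pmatrix},\qquad J_{4,r}=\begin{pmatrix}\frac12&0&0&-1\\0&-\frac12&\frac12&0\end{pmatrix},$$ $$J_{5,r}(\alpha_1)=\begin{pmatrix}\alpha_1&0&0&0\\0&-1+2\alpha_1&-\alpha_1+1&0\end{pmatrix},\ \text{where }\alpha_1\in\mathbb{R},\ \alpha_1\neq\tfrac1{10}(5\pm\sqrt5),$$ $$J_{6,r}(\alpha_1)=\begin{pmatrix}\alpha_1&0&0&0\\0&\sqrt{\alpha_1-\alpha_1^2}&-\alpha_1+1&0\end{pmatrix},\ \text{where }0\le\alpha_1\le1,$$ $$J_{7,r}(\alpha_1)=\begin{pmatrix}\alpha_1&0&0&0\\0&-\sqrt{\alpha_1-\alpha_1^2}&-\alpha_1+1&0\end{pmatrix},\ \text{where }0<\alpha_1<1,$$ $$J_{8,r}=\begin{pmatrix}\frac1{10}(5-\sqrt5)&0&0&0\\1&-\frac{\sqrt5}5&\frac1{10}(5+\sqrt5)&0\end{pmatrix},\qquad J_{9,r}=\begin{pmatrix}\frac1{10}(5+\sqrt5)&0&0&0\\1&\frac{\sqrt5}5&\frac1{10}(5-\sqrt5)&0\end{pmatrix},$$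 $$J_{10,r}=\begin{pmatrix}\frac13&0&0&0\\0&\frac23&-\frac13&0\end{pmatrix},\qquad J_{11,r}=\begin{pmatrix}0&0&0&0\\1&0&0&0\end{pmatrix}.$$
   Context: An algebra over a field $\mathbb{F}$ is an $\mathbb{F}$-vector space $\mathbb{A}$ with a bilinear multiplication $\cdot$ (not assumed associative, commutative or unital); it is nontrivial if the multiplication is not identically zero. Two algebras are isomorphic if there is an invertible linear map between them preserving the multiplication. An algebra $\mathbb{A}$ is a Jordan algebra if $(\mathbf{u}\cdot\mathbf{v})\cdot\mathbf{u}^2=\mathbf{u}\cdot(\mathbf{v}\cdot\mathbf{u}^2)$ for all $\mathbf{u},\mathbf{v}\in\mathbb{A}$, where $\mathbf{u}^2=\mathbf{u}\cdot\mathbf{u}$; commutativity is NOT assumed. The matrix of structure constants $A=\begin{pmatrix}\alpha_1&\alpha_2&\alpha_3&\alpha_4\\\beta_1&\beta_2&\beta_3&\beta_4\end{pmatrix}$ of a $2$-dimensional algebra with respect to a basis $(e^1,e^2)$ is defined by $e^1\cdot e^1=\alpha_1e^1+\beta_1e^2$, $e^1\cdot e^2=\alpha_2e^1+\beta_2e^2$, $e^2\cdot e^1=\alpha_3e^1+\beta_3e^2$, $e^2\cdot e^2=\alpha_4e^1+\beta_4e^2$. An algebra is identified with its matrix of structure constants. *)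

theory Defs
  imports "HOL-Analysis.Analysis"
begin

text \<open>
  An algebra is given by a bilinear multiplication \<open>m\<close> on a real vector space; no associativity,
  commutativity or unit is assumed.
\<close>

definition nontrivial_algebra :: "('a::real_vector \<Rightarrow> 'a \<Rightarrow> 'a) \<Rightarrow> bool" where
  "nontrivial_algebra m \<longleftrightarrow> (\<exists>u v. m u v \<noteq> 0)"

text \<open>The Jordan identity \<open>(u v) u\<^sup>2 = u (v u\<^sup>2)\<close>, without commutativity.\<close>

definition jordan_algebra :: "('a::real_vector \<Rightarrow> 'a \<Rightarrow> 'a) \<Rightarrow> bool" where
  "jordan_algebra m \<longleftrightarrow> bilinear m \<and> (\<forall>u v. m (m u v) (m u u) = m u (m v (m u u)))"

definition isomorphic_algebras ::
  "('a::real_vector \<Rightarrow> 'a \<Rightarrow> 'a) \<Rightarrow> ('b::real_vector \<Rightarrow> 'b \<Rightarrow> 'b) \<Rightarrow> bool" where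
  "isomorphic_algebras m m' \<longleftrightarrow>
     (\<exists>f. linear f \<and> bij f \<and> (\<forall>u v. f (m u v) = m' (f u) (f v)))"

text \<open>
  The algebra on \<open>\<real>\<^sup>2\<close> whose matrix of structure constants with respect to the standard basis
  \<open>(e\<^sub>1, e\<^sub>2)\<close> is \<open>A\<close>: the columns of \<open>A\<close> are the coordinates of
  \<open>e\<^sub>1 e\<^sub>1\<close>, \<open>e\<^sub>1 e\<^sub>2\<close>, \<open>e\<^sub>2 e\<^sub>1\<close>, \<open>e\<^sub>2 e\<^sub>2\<close>, in this order.
\<close>

definition algebra_of_matrix :: "real^4^2 \<Rightarrow> real^2 \<Rightarrow> real^2 \<Rightarrow> real^2" where
  "algebra_of_matrix A u v =
     (u$1 * v$1) *\<^sub>R column 1 A + (u$1 * v$2) *\<^sub>R column 2 A +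
     (u$2 * v$1) *\<^sub>R column 3 A + (u$2 * v$2) *\<^sub>R column 4 A"

lemma algebra_of_matrix_basis:
  fixes A :: "real^4^2"
  defines "e1 \<equiv> axis 1 1 :: real^2" and "e2 \<equiv> axis 2 1 :: real^2"
  shows "algebra_of_matrix A e1 e1 = A$1$1 *\<^sub>R e1 + A$2$1 *\<^sub>R e2"
    and "algebra_of_matrix A e1 e2 = A$1$2 *\<^sub>R e1 + A$2$2 *\<^sub>R e2"
    and "algebra_of_matrix A e2 e1 = A$1$3 *\<^sub>R e1 + A$2$3 *\<^sub>R e2"
    and "algebra_of_matrix A e2 e2 = A$1$4 *\<^sub>R e1 + A$2$4 *\<^sub>R e2"
  by (simp_all add: e1_def e2_def algebra_of_matrix_def column_def vec_eq_iff forall_2 axis_def)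

lemma bilinear_algebra_of_matrix: "bilinear (algebra_of_matrix A)"
  by (auto simp: bilinear_def algebra_of_matrix_def algebra_simps intro!: linearI)

lemma vector_2_4:
  fixes a1 a2 a3 a4 b1 b2 b3 b4 :: real
  defines "A \<equiv> vector [vector [a1, a2, a3, a4], vector [b1, b2, b3, b4]] :: real^4^2"
  shows "A$1$1 = a1" "A$1$2 = a2" "A$1$3 = a3" "A$1$4 = a4"
        "A$2$1 = b1" "A$2$2 = b2" "A$2$3 = b3" "A$2$4 = b4"
  by (simp_all add: A_def vector_def)

text \<open>
  Entries of the list are labels, so that different parameter values are different entries
  by construction.
\<close>

datatype jordan_label =
  J1 | J2 | J3 | J4 | J5 real | J6 real | J7 real | J8 | J9 | J10 | J11

fun admissible :: "jordan_label \<Rightarrow> bool" where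
  "admissible (J5 a) \<longleftrightarrow> a \<noteq> 1/10 * (5 + sqrt 5) \<and> a \<noteq> 1/10 * (5 - sqrt 5)"
| "admissible (J6 a) \<longleftrightarrow> 0 \<le> a \<and> a \<le> 1"
| "admissible (J7 a) \<longleftrightarrow> 0 < a \<and> a < 1"
| "admissible _ \<longleftrightarrow> True"

fun jordan_matrix :: "jordan_label \<Rightarrow> real^4^2" where
  "jordan_matrix J1 =
     vector [vector [1/2, 0, 0, 1],
             vector [0, 1/2, 1/2, 0]]"
| "jordan_matrix J2 =
     vector [vector [1/2, 0, 0, 1],
             vector [0, - (1/2), 1/2, 0]]"
| "jordan_matrix J3 =
     vector [vector [1/2, 0, 0, - 1],
             vector [0, 1/2, 1/2, 0]]"
| "jordan_matrix J4 =
     vector [vector [1/2, 0, 0, - 1],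
             vector [0, - (1/2), 1/2, 0]]"
| "jordan_matrix (J5 a) =
     vector [vector [a, 0, 0, 0],
             vector [0, - 1 + 2 * a, - a + 1, 0]]"
| "jordan_matrix (J6 a) =
     vector [vector [a, 0, 0, 0],
             vector [0, sqrt (a - a\<^sup>2), - a + 1, 0]]"
| "jordan_matrix (J7 a) =
     vector [vector [a, 0, 0, 0],
             vector [0, - sqrt (a - a\<^sup>2), - a + 1, 0]]"
| "jordan_matrix J8 =
     vector [vector [1/10 * (5 - sqrt 5), 0, 0, 0],
             vector [1, - (sqrt 5 / 5), 1/10 * (5 + sqrt 5), 0]]"
| "jordan_matrix J9 =
     vector [vector [1/10 * (5 + sqrt 5), 0, 0, 0],
             vector [1, sqrt 5 / 5, 1/10 * (5 - sqrt 5), 0]]"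
| "jordan_matrix J10 =
     vector [vector [1/3, 0, 0, 0],
             vector [0, 2/3, - (1/3), 0]]"
| "jordan_matrix J11 =
     vector [vector [0, 0, 0, 0],
             vector [1, 0, 0, 0]]"

end

theory Submission
  imports Defs
begin

text \<open>
  The classification rests on two linear functionals that every algebra carries: the traces
  \<open>u \<mapsto> tr (v \<mapsto> v u)\<close> and \<open>u \<mapsto> tr (v \<mapsto> u v)\<close> of right and left multiplication. Since they
  do not depend on a basis, they single out a good one. If the right trace is not zero, take \<open>y\<close> in
  its kernel and \<open>x\<close> with right trace \<open>1\<close>; if it is zero, do the same with the left trace; if both
  are zero, any basis serves. In the first two cases all that remains free is
  \<open>x \<mapsto> x + t y\<close>, \<open>y \<mapsto> d y\<close> with \<open>d \<noteq> 0\<close>.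

  Existence. In such a basis the Jordan identity at a few vectors leaves few possibilities.
  If \<open>y\<^sup>2\<close> is not a multiple of \<open>y\<close>, a shift of \<open>x\<close> makes \<open>y\<^sup>2 = r x\<close> and \<open>x y\<close> a multiple of \<open>y\<close>,
  and then \<open>jordan_square_transversal\<close> leaves, up to scaling \<open>y\<close>, only two signs
  open: these are \<open>J1\<close> to \<open>J4\<close> (and \<open>J11\<close> if the traces vanish). Otherwise \<open>y\<^sup>2 = 0\<close>
  (\<open>jordan_kernel_vector_square_zero\<close>), the line of \<open>y\<close> is an ideal, and with
  \<open>x\<^sup>2 = a x + c y\<close>, \<open>x y = p y\<close>, \<open>y x = h y\<close> the Jordan identity becomes
  \<open>c (a h - p\<^sup>2) = 0\<close> and \<open>(p + h - a) (a h - p\<^sup>2) = 0\<close> (\<open>jordan_kernel_vector_ideal\<close>). With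
  \<open>a + h = 1\<close> the factor \<open>p + h - a\<close> gives the line \<open>J5\<close> and the factor \<open>a h - p\<^sup>2\<close> the circle
  \<open>p\<^sup>2 = a (1 - a)\<close>, halved into \<open>J6\<close> and \<open>J7\<close>. A shift of \<open>x\<close> removes \<open>c\<close> unless \<open>p + h = a\<close>;
  this happens on the circle only at its two intersections with the line, where \<open>c \<noteq> 0\<close> yields \<open>J8\<close>
  and \<open>J9\<close>. With \<open>a + h = 0\<close> only \<open>J10\<close> and \<open>J11\<close> survive.

  Uniqueness. The traces separate \<open>J1\<close> to \<open>J9\<close>, \<open>J10\<close> and \<open>J11\<close>. Within the first group an
  isomorphism is one of the remaining base changes, and these preserve \<open>a\<close>, \<open>p\<close>, \<open>sgn r\<close> and, if
  \<open>p + h = a\<close>, also whether \<open>c\<close> vanishes (\<open>trace_normalised_invariants\<close>). The label can be read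
  off from these data (\<open>label_of_invariants_jordan_matrix\<close>).
\<close>

section \<open>Bases and structure constants\<close>

definition basis_pair :: "'a::real_vector \<Rightarrow> 'a \<Rightarrow> bool" where
  "basis_pair x y \<longleftrightarrow>
     (\<forall>s t. s *\<^sub>R x + t *\<^sub>R y = 0 \<longrightarrow> s = 0 \<and> t = 0) \<and>
     (\<forall>v. \<exists>s t. v = s *\<^sub>R x + t *\<^sub>R y)"

lemma basis_pair_eq_iff:
  assumes "basis_pair x y"
  shows "s *\<^sub>R x + t *\<^sub>R y = s' *\<^sub>R x + t' *\<^sub>R y \<longleftrightarrow> s = s' \<and> t = t'"
proof
  assume "s *\<^sub>R x + t *\<^sub>R y = s' *\<^sub>R x + t' *\<^sub>R y"
  then have "(s - s') *\<^sub>R x + (t - t') *\<^sub>R y = 0"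
    by (simp add: algebra_simps)
  with assms have "s - s' = 0 \<and> t - t' = 0"
    unfolding basis_pair_def by blast
  then show "s = s' \<and> t = t'" by simp
qed simp

lemma basis_pair_exists:
  assumes "dim (UNIV :: 'a::real_vector set) = 2"
  shows "\<exists>x y :: 'a. basis_pair x y"
proof -
  obtain B :: "'a set" where B: "independent B" "UNIV \<subseteq> span B" "card B = 2"
    using basis_exists[of "UNIV :: 'a set"] assms by metis
  then obtain x y where xy: "B = {x, y}" "x \<noteq> y"
    by (auto simp: card_2_iff)
  have "s = 0 \<and> t = 0" if "s *\<^sub>R x + t *\<^sub>R y = 0" for s t
  proof -
    let ?c = "\<lambda>v. if v = x then s else t"
    have "(\<Sum>v\<in>{x, y}. ?c v *\<^sub>R v) = 0"
      using xy that by auto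
    then have "?c v = 0" if "v \<in> {x, y}" for v
      using B(1) xy that independentD[of B "{x, y}" ?c v] by auto
    from this[of x] this[of y] xy show ?thesis by auto
  qed
  moreover have "\<exists>s t. v = s *\<^sub>R x + t *\<^sub>R y" for v
  proof -
    have "v \<in> span {x, y}" using B(2) xy by auto
    then obtain k where "v - k *\<^sub>R x \<in> span {y}"
      using span_breakdown_eq by blast
    then obtain l where "v - k *\<^sub>R x - l *\<^sub>R y = 0"
      using span_breakdown_eq[of _ y "{}"] by auto
    then have "v = k *\<^sub>R x + l *\<^sub>R y" by (simp add: algebra_simps)
    then show ?thesis by blast
  qed
  ultimately show ?thesis unfolding basis_pair_def by blast
qed

lemma basis_pair_change:
  assumes b: "basis_pair x y" and d: "p * s - q * r \<noteq> 0"
  shows "basis_pair (p *\<^sub>R x + q *\<^sub>R y) (r *\<^sub>R x + s *\<^sub>R y)"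
  unfolding basis_pair_def
proof (intro conjI allI impI)
  fix a c assume "a *\<^sub>R (p *\<^sub>R x + q *\<^sub>R y) + c *\<^sub>R (r *\<^sub>R x + s *\<^sub>R y) = 0"
  then have "(a * p + c * r) *\<^sub>R x + (a * q + c * s) *\<^sub>R y = 0 *\<^sub>R x + 0 *\<^sub>R y"
    by (simp add: algebra_simps)
  then have e: "a * p + c * r = 0" "a * q + c * s = 0"
    by (simp_all only: basis_pair_eq_iff[OF b])
  have "a * (p * s - q * r) = 0" "c * (p * s - q * r) = 0"
    using e by algebra+
  with d show "a = 0" "c = 0" by auto
next
  fix v
  obtain a c where v: "v = a *\<^sub>R x + c *\<^sub>R y"
    using b unfolding basis_pair_def by blast
  define a' where "a' = (a * s - c * r) / (p * s - q * r)"
  define c' where "c' = (c * p - a * q) / (p * s - q * r)"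
  have "a' * (p * s - q * r) = a * s - c * r" "c' * (p * s - q * r) = c * p - a * q"
    using d by (simp_all add: a'_def c'_def)
  then have "(p * s - q * r) * (a' * p + c' * r) = (p * s - q * r) * a"
    "(p * s - q * r) * (a' * q + c' * s) = (p * s - q * r) * c"
    by algebra+
  then have e: "a' * p + c' * r = a" "a' * q + c' * s = c"
    using d by simp_all
  have "v = a' *\<^sub>R (p *\<^sub>R x + q *\<^sub>R y) + c' *\<^sub>R (r *\<^sub>R x + s *\<^sub>R y)"
    unfolding v e[symmetric] by (simp add: algebra_simps)
  then show "\<exists>a c. v = a *\<^sub>R (p *\<^sub>R x + q *\<^sub>R y) + c *\<^sub>R (r *\<^sub>R x + s *\<^sub>R y)"
    by blast
qed

lemma basis_pair_coordinates:
  assumes "basis_pair x y" "basis_pair x' y'"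
  obtains p q r s where "x' = p *\<^sub>R x + q *\<^sub>R y" "y' = r *\<^sub>R x + s *\<^sub>R y" "p * s - q * r \<noteq> 0"
proof -
  obtain p q r s where e: "x' = p *\<^sub>R x + q *\<^sub>R y" "y' = r *\<^sub>R x + s *\<^sub>R y"
    using assms(1) unfolding basis_pair_def by metis
  have "False" if "p * s - q * r = 0"
  proof -
    have "s *\<^sub>R x' + (- q) *\<^sub>R y' = (p * s - q * r) *\<^sub>R x"
      "r *\<^sub>R x' + (- p) *\<^sub>R y' = - (p * s - q * r) *\<^sub>R y"
      unfolding e by (simp_all add: algebra_simps)
    then have "s *\<^sub>R x' + (- q) *\<^sub>R y' = 0" "r *\<^sub>R x' + (- p) *\<^sub>R y' = 0"
      using that by simp_all
    then have "- q = 0" "- p = 0"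
      using assms(2) unfolding basis_pair_def by blast+
    then have "1 *\<^sub>R x' + 0 *\<^sub>R y' = 0" using e by simp
    then have "(1::real) = 0" using assms(2) unfolding basis_pair_def by blast
    then show False by simp
  qed
  with e that show thesis by blast
qed

definition structure_constants ::
  "('a::real_vector \<Rightarrow> 'a \<Rightarrow> 'a) \<Rightarrow> 'a \<Rightarrow> 'a \<Rightarrow>
     real \<Rightarrow> real \<Rightarrow> real \<Rightarrow> real \<Rightarrow> real \<Rightarrow> real \<Rightarrow> real \<Rightarrow> real \<Rightarrow> bool" where
  "structure_constants m x y a1 a2 a3 a4 b1 b2 b3 b4 \<longleftrightarrow>
     basis_pair x y \<and>
     m x x = a1 *\<^sub>R x + b1 *\<^sub>R y \<and> m x y = a2 *\<^sub>R x + b2 *\<^sub>R y \<and>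
     m y x = a3 *\<^sub>R x + b3 *\<^sub>R y \<and> m y y = a4 *\<^sub>R x + b4 *\<^sub>R y"

lemma bilinear_expand:
  assumes "bilinear m"
  shows "m (p *\<^sub>R x + q *\<^sub>R y) (r *\<^sub>R x + s *\<^sub>R y) =
    (p * r) *\<^sub>R m x x + (p * s) *\<^sub>R m x y + (q * r) *\<^sub>R m y x + (q * s) *\<^sub>R m y y"
  using assms
  by (simp add: bilinear_ladd bilinear_radd bilinear_lmul bilinear_rmul algebra_simps)

text \<open>
  One coordinate of the product of \<open>p x + q y\<close> and \<open>r x + s y\<close>: the coefficients are one row of the
  matrix of structure constants.
\<close>

definition bil_form :: "real \<Rightarrow> real \<Rightarrow> real \<Rightarrow> real \<Rightarrow> real \<Rightarrow> real \<Rightarrow> real \<Rightarrow> real \<Rightarrow> real" where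
  "bil_form c1 c2 c3 c4 p q r s = c1 * (p * r) + c2 * (p * s) + c3 * (q * r) + c4 * (q * s)"

lemma structure_constants_mult:
  assumes "bilinear m" "structure_constants m x y a1 a2 a3 a4 b1 b2 b3 b4"
  shows "m (p *\<^sub>R x + q *\<^sub>R y) (r *\<^sub>R x + s *\<^sub>R y) =
    bil_form a1 a2 a3 a4 p q r s *\<^sub>R x + bil_form b1 b2 b3 b4 p q r s *\<^sub>R y"
  using assms(2) unfolding bilinear_expand[OF assms(1)] structure_constants_def bil_form_def
  by (simp add: algebra_simps)

lemma structure_constants_exist:
  assumes "basis_pair x y"
  obtains a1 a2 a3 a4 b1 b2 b3 b4 where "structure_constants m x y a1 a2 a3 a4 b1 b2 b3 b4"
  using assms unfolding structure_constants_def basis_pair_def by metis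

definition has_structure_matrix :: "('a::real_vector \<Rightarrow> 'a \<Rightarrow> 'a) \<Rightarrow> real^4^2 \<Rightarrow> bool" where
  "has_structure_matrix m A \<longleftrightarrow>
     (\<exists>x y. structure_constants m x y (A$1$1) (A$1$2) (A$1$3) (A$1$4) (A$2$1) (A$2$2) (A$2$3) (A$2$4))"

text \<open>
  Sending a basis to the standard basis of the plane turns isomorphisms onto the algebra of a matrix
  into bases in which that matrix holds the structure constants. Hence both existence and uniqueness
  become questions about bases of the one given algebra.
\<close>

lemma isomorphic_algebras_iff_structure_matrix:
  fixes m :: "'a::real_vector \<Rightarrow> 'a \<Rightarrow> 'a" and A :: "real^4^2"
  assumes "bilinear m"
  shows "isomorphic_algebras m (algebra_of_matrix A) \<longleftrightarrow>
    has_structure_matrix m A"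
  unfolding has_structure_matrix_def
proof
  assume "isomorphic_algebras m (algebra_of_matrix A)"
  then obtain f where f: "linear f" "bij f" "\<And>u v. f (m u v) = algebra_of_matrix A (f u) (f v)"
    unfolding isomorphic_algebras_def by blast
  define g where "g = inv f"
  have fg: "f (g w) = w" for w
    using f(2) by (simp add: g_def bij_is_surj surj_f_inv_f)
  have gf: "g (f w) = w" for w
    using f(2) by (simp add: g_def bij_is_inj)
  define x where "x = g (axis 1 1)"
  define y where "y = g (axis 2 1)"
  have fx: "f x = axis 1 1" and fy: "f y = axis 2 1" by (simp_all add: x_def y_def fg)
  have lin: "f (s *\<^sub>R x + t *\<^sub>R y) = s *\<^sub>R axis 1 1 + t *\<^sub>R axis 2 1" for s t
    using f(1) by (simp add: linear_add linear_scale fx fy)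
  have eqI: "u = s *\<^sub>R x + t *\<^sub>R y" if "f u = s *\<^sub>R axis 1 1 + t *\<^sub>R axis 2 1" for u s t
    using that lin gf by metis
  have "s = 0 \<and> t = 0" if "s *\<^sub>R x + t *\<^sub>R y = 0" for s t
  proof -
    have "s *\<^sub>R axis 1 1 + t *\<^sub>R axis 2 1 = (0 :: real^2)"
      using lin[of s t] that f(1) by (simp add: linear_0)
    then show ?thesis by (auto simp: vec_eq_iff forall_2 axis_def)
  qed
  moreover have "\<exists>s t. v = s *\<^sub>R x + t *\<^sub>R y" for v
  proof -
    have "f v = (f v $ 1) *\<^sub>R axis 1 1 + (f v $ 2) *\<^sub>R axis 2 1"
      by (simp add: vec_eq_iff forall_2 axis_def)
    from eqI[OF this] show ?thesis by blast
  qed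
  ultimately have "basis_pair x y" unfolding basis_pair_def by blast
  then show "\<exists>x y. structure_constants m x y (A$1$1) (A$1$2) (A$1$3) (A$1$4) (A$2$1) (A$2$2) (A$2$3) (A$2$4)"
    unfolding structure_constants_def
    by (intro exI conjI) (assumption, (rule eqI, simp only: f(3) fx fy algebra_of_matrix_basis)+)
next
  assume "\<exists>x y. structure_constants m x y (A$1$1) (A$1$2) (A$1$3) (A$1$4) (A$2$1) (A$2$2) (A$2$3) (A$2$4)"
  then obtain x y where sc:
    "structure_constants m x y (A$1$1) (A$1$2) (A$1$3) (A$1$4) (A$2$1) (A$2$2) (A$2$3) (A$2$4)"
    by blast
  then have b: "basis_pair x y" by (simp add: structure_constants_def)
  define g :: "real^2 \<Rightarrow> 'a" where "g = (\<lambda>w. (w$1) *\<^sub>R x + (w$2) *\<^sub>R y)"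
  have g: "linear g" by (auto simp: g_def algebra_simps intro!: linearI)
  have bij: "bij g"
  proof (rule bijI)
    show "inj g"
      by (rule injI) (auto simp: g_def basis_pair_eq_iff[OF b] vec_eq_iff forall_2)
    have "\<exists>w. v = g w" for v
    proof -
      obtain s t where "v = s *\<^sub>R x + t *\<^sub>R y" using b unfolding basis_pair_def by blast
      then have "v = g (vector [s, t])" by (simp add: g_def)
      then show ?thesis by blast
    qed
    then show "surj g" by (simp add: surj_def)
  qed
  have "g (algebra_of_matrix A u v) = m (g u) (g v)" for u v
    unfolding g_def structure_constants_mult[OF assms sc]
    by (simp add: algebra_of_matrix_def column_def bil_form_def algebra_simps)
  then have "inv g (m u v) = algebra_of_matrix A (inv g u) (inv g v)" for u v
    using bij by (metis bij_inv_eq_iff)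
  moreover have "linear (inv g)"
  proof (rule linearI)
    fix u v and c :: real
    have s: "g (inv g w) = w" for w using bij by (simp add: bij_is_surj surj_f_inv_f)
    have i: "inv g (g w) = w" for w using bij by (simp add: bij_is_inj)
    show "inv g (u + v) = inv g u + inv g v"
      using linear_add[OF g, of "inv g u" "inv g v"] s i by metis
    show "inv g (c *\<^sub>R u) = c *\<^sub>R inv g u"
      using linear_scale[OF g, of c "inv g u"] s i by metis
  qed
  ultimately show "isomorphic_algebras m (algebra_of_matrix A)"
    unfolding isomorphic_algebras_def using bij bij_imp_bij_inv by blast
qed

text \<open>
  Comparing coordinates in the old basis keeps the equations of a base change polynomial; the inverse
  of the transition matrix never appears.
\<close>

lemma structure_constants_change_iff:
  assumes "bilinear m" "structure_constants m x y a1 a2 a3 a4 b1 b2 b3 b4" "p * s - q * r \<noteq> 0"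
  shows "structure_constants m (p *\<^sub>R x + q *\<^sub>R y) (r *\<^sub>R x + s *\<^sub>R y) c1 c2 c3 c4 d1 d2 d3 d4 \<longleftrightarrow>
    bil_form a1 a2 a3 a4 p q p q = c1 * p + d1 * r \<and> bil_form b1 b2 b3 b4 p q p q = c1 * q + d1 * s \<and>
    bil_form a1 a2 a3 a4 p q r s = c2 * p + d2 * r \<and> bil_form b1 b2 b3 b4 p q r s = c2 * q + d2 * s \<and>
    bil_form a1 a2 a3 a4 r s p q = c3 * p + d3 * r \<and> bil_form b1 b2 b3 b4 r s p q = c3 * q + d3 * s \<and>
    bil_form a1 a2 a3 a4 r s r s = c4 * p + d4 * r \<and> bil_form b1 b2 b3 b4 r s r s = c4 * q + d4 * s"
proof -
  have b: "basis_pair x y" using assms(2) by (simp add: structure_constants_def)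
  have c: "u *\<^sub>R (p *\<^sub>R x + q *\<^sub>R y) + v *\<^sub>R (r *\<^sub>R x + s *\<^sub>R y) =
      (u * p + v * r) *\<^sub>R x + (u * q + v * s) *\<^sub>R y" for u v
    by (simp add: algebra_simps)
  show ?thesis
    unfolding structure_constants_def[of m "p *\<^sub>R x + q *\<^sub>R y"]
      structure_constants_mult[OF assms(1,2)] c basis_pair_eq_iff[OF b]
    using basis_pair_change[OF b assms(3)] by blast
qed

lemma structure_constants_shift:
  assumes "bilinear m" "structure_constants m x y a1 a2 a3 a4 b1 b2 b3 b4"
  shows "structure_constants m (x + t *\<^sub>R y) y
    (a1 + t * a2 + t * a3 + t * t * a4) (a2 + t * a4) (a3 + t * a4) a4
    (b1 + t * b2 + t * b3 + t * t * b4 - t * (a1 + t * a2 + t * a3 + t * t * a4))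
    (b2 + t * b4 - t * (a2 + t * a4)) (b3 + t * b4 - t * (a3 + t * a4)) (b4 - t * a4)"
  using structure_constants_change_iff[OF assms, of 1 1 t 0]
  by (simp add: bil_form_def algebra_simps)

lemma structure_constants_scale:
  assumes "bilinear m" "structure_constants m x y a1 a2 a3 a4 b1 b2 b3 b4" "d \<noteq> 0"
  shows "structure_constants m x (d *\<^sub>R y)
    a1 (d * a2) (d * a3) (d * d * a4) (b1 / d) b2 b3 (d * b4)"
  using structure_constants_change_iff[OF assms(1,2), of 1 d 0 0] assms(3)
  by (simp add: bil_form_def algebra_simps)

lemma structure_constants_swap:
  assumes "bilinear m" "structure_constants m x y a1 a2 a3 a4 b1 b2 b3 b4"
  shows "structure_constants m y x b4 b3 b2 b1 a4 a3 a2 a1"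
  using structure_constants_change_iff[OF assms, of 0 0 1 1]
  by (simp add: bil_form_def)

section \<open>The trace functionals\<close>

text \<open>
  The numbers \<open>a1 + b3\<close> and \<open>a2 + b4\<close> are the traces of right multiplication by \<open>x\<close> and by \<open>y\<close>, so
  they transform like the values of a linear functional. The proof multiplies the claim by the
  determinant \<open>D\<close> of the base change and uses \<open>D tr R = det (R x', y') + det (x', R y')\<close>, with
  determinants in the old coordinates.
\<close>

lemma right_trace_change:
  assumes "bilinear m" "structure_constants m x y a1 a2 a3 a4 b1 b2 b3 b4"
    "structure_constants m (p *\<^sub>R x + q *\<^sub>R y) (r *\<^sub>R x + s *\<^sub>R y) c1 c2 c3 c4 d1 d2 d3 d4"
    and d: "p * s - q * r \<noteq> 0"
  shows "c1 + d3 = p * (a1 + b3) + q * (a2 + b4)"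
    and "c2 + d4 = r * (a1 + b3) + s * (a2 + b4)"
proof -
  note e = assms(3)[unfolded structure_constants_change_iff[OF assms(1,2) d]]
  have "(p * s - q * r) * (c1 + d3) =
      (c1 * p + d1 * r) * s - (c1 * q + d1 * s) * r + p * (c3 * q + d3 * s) - q * (c3 * p + d3 * r)"
    by (simp add: algebra_simps)
  also have "\<dots> = bil_form a1 a2 a3 a4 p q p q * s - bil_form b1 b2 b3 b4 p q p q * r
      + p * bil_form b1 b2 b3 b4 r s p q - q * bil_form a1 a2 a3 a4 r s p q"
    using e by simp
  also have "\<dots> = (p * s - q * r) * (p * (a1 + b3) + q * (a2 + b4))"
    by (simp add: bil_form_def algebra_simps)
  finally show "c1 + d3 = p * (a1 + b3) + q * (a2 + b4)" using d by simp
  have "(p * s - q * r) * (c2 + d4) =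
      (c2 * p + d2 * r) * s - (c2 * q + d2 * s) * r + p * (c4 * q + d4 * s) - q * (c4 * p + d4 * r)"
    by (simp add: algebra_simps)
  also have "\<dots> = bil_form a1 a2 a3 a4 p q r s * s - bil_form b1 b2 b3 b4 p q r s * r
      + p * bil_form b1 b2 b3 b4 r s r s - q * bil_form a1 a2 a3 a4 r s r s"
    using e by simp
  also have "\<dots> = (p * s - q * r) * (r * (a1 + b3) + s * (a2 + b4))"
    by (simp add: bil_form_def algebra_simps)
  finally show "c2 + d4 = r * (a1 + b3) + s * (a2 + b4)" using d by simp
qed

text \<open>
  The left trace is the right trace of the opposite algebra.
\<close>

lemma structure_constants_opposite:
  "structure_constants m x y a1 a2 a3 a4 b1 b2 b3 b4 \<Longrightarrow>
   structure_constants (\<lambda>u v. m v u) x y a1 a3 a2 a4 b1 b3 b2 b4"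
  unfolding structure_constants_def by blast

lemma bilinear_opposite: "bilinear m \<Longrightarrow> bilinear (\<lambda>u v. m v u)"
  by (simp add: bilinear_def)

lemma left_trace_change:
  assumes "bilinear m" "structure_constants m x y a1 a2 a3 a4 b1 b2 b3 b4"
    "structure_constants m (p *\<^sub>R x + q *\<^sub>R y) (r *\<^sub>R x + s *\<^sub>R y) c1 c2 c3 c4 d1 d2 d3 d4"
    "p * s - q * r \<noteq> 0"
  shows "c1 + d2 = p * (a1 + b2) + q * (a3 + b4)"
    and "c3 + d4 = r * (a1 + b2) + s * (a3 + b4)"
  by (fact right_trace_change[OF bilinear_opposite[OF assms(1)]
      assms(2)[THEN structure_constants_opposite] assms(3)[THEN structure_constants_opposite] assms(4)])+

section \<open>The Jordan identity in an adapted basis\<close>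

lemma jordan_coordinates:
  fixes a1 a2 a3 a4 b1 b2 b3 b4 p q r s :: real
  defines "f \<equiv> bil_form a1 a2 a3 a4" and "g \<equiv> bil_form b1 b2 b3 b4"
  assumes "jordan_algebra m" "structure_constants m x y a1 a2 a3 a4 b1 b2 b3 b4"
  shows "f (f p q r s) (g p q r s) (f p q p q) (g p q p q) =
      f p q (f r s (f p q p q) (g p q p q)) (g r s (f p q p q) (g p q p q))"
    and "g (f p q r s) (g p q r s) (f p q p q) (g p q p q) =
      g p q (f r s (f p q p q) (g p q p q)) (g r s (f p q p q) (g p q p q))"
proof -
  have bil: "bilinear m" using assms(3) by (simp add: jordan_algebra_def)
  have b: "basis_pair x y" using assms(4) by (simp add: structure_constants_def)
  note mult = structure_constants_mult[OF bil assms(4), folded f_def g_def]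
  let ?u = "p *\<^sub>R x + q *\<^sub>R y" and ?v = "r *\<^sub>R x + s *\<^sub>R y"
  have "m (m ?u ?v) (m ?u ?u) = m ?u (m ?v (m ?u ?u))"
    using assms(3) by (simp add: jordan_algebra_def)
  then show "f (f p q r s) (g p q r s) (f p q p q) (g p q p q) =
      f p q (f r s (f p q p q) (g p q p q)) (g r s (f p q p q) (g p q p q))"
    "g (f p q r s) (g p q r s) (f p q p q) (g p q p q) =
      g p q (f r s (f p q p q) (g p q p q)) (g r s (f p q p q) (g p q p q))"
    unfolding mult basis_pair_eq_iff[OF b] by auto
qed

text \<open>
  The Jordan identity at \<open>u = y\<close> expresses \<open>r a\<close> and \<open>r c\<close> through \<open>g\<close> and \<open>h\<close>, and \<open>u = x\<close> and
  \<open>u = x + y\<close> supply the rest.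
  Were \<open>g \<noteq> 0\<close> in the case \<open>a + h = 1\<close>, then in terms of \<open>z = y - g x\<close> the algebra would be
  \<open>x x = x\<close>, \<open>x z = z\<close>, \<open>z x = 0\<close>, \<open>z z = - g z\<close>, and the Jordan identity fails there for \<open>v = x\<close> and
  \<open>u = x + z\<close> or \<open>u = x - z\<close>.
\<close>

lemma jordan_square_transversal:
  assumes J: "jordan_algebra m" and sc: "structure_constants m x y a 0 g r c p h 0" and r: "r \<noteq> 0"
  shows "r * a = g * g + h * r" and "r * c = g * h"
    and "a + h = 1 \<Longrightarrow> g = 0"
    and "g = 0 \<Longrightarrow> (h - p) * (h + p) = 0"
proof -
  note j = jordan_coordinates[OF J sc, unfolded bil_form_def]
  have "r * (r * a) = r * (g * g + h * r)"
    using j(1)[where p=0 and q=1 and r=0 and s=1] by (simp add: algebra_simps)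
  then show a: "r * a = g * g + h * r" using r by simp
  have "r * (r * c) = r * (g * h)"
    using j(2)[where p=0 and q=1 and r=0 and s=1] by (simp add: algebra_simps)
  then show c: "r * c = g * h" using r by simp
  have e: "a * (g * p) + p * (r * c) = a * (a * g) + a * (r * c)"
    "c * (g * a) + c * (r * c) = 0"
    using j[where p=1 and q=0 and r=0 and s=1] by (simp_all add: algebra_simps)
  have f: "(a + h) * (g * (p - a)) = 0" "(a + h) * (g * c) = 0"
    using e unfolding c by (simp_all add: algebra_simps)
  show "g = 0" if tr: "a + h = 1"
  proof (rule ccontr)
    assume g: "g \<noteq> 0"
    then have "p = a" "c = 0" using f tr by simp_all
    with c g tr have v: "p = 1" "a = 1" "h = 0" "c = 0" by simp_all
    with a have r: "r = g * g" by simp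
    \<comment> \<open>in terms of \<open>z = y - g x\<close>, the vectors \<open>u\<close> are \<open>x + z\<close> and \<open>x - z\<close>\<close>
    have "g * (1 - g) = 0" "g * (1 + g) = 0"
      using j(2)[where p="1 - g" and q=1 and r=1 and s=0]
        j(2)[where p="1 + g" and q="-1" and r=1 and s=0]
      unfolding v r by (simp_all add: algebra_simps)
    with g show False by simp
  qed
  show "(h - p) * (h + p) = 0" if "g = 0"
  proof -
    have "a = h" "c = 0" using a c r that by simp_all
    then have "r * ((h - p) * (h + p)) = 0"
      using j(1)[where p=1 and q=1 and r=1 and s=0] that by (simp add: algebra_simps)
    with r show ?thesis by simp
  qed
qed

text \<open>
  The coefficient \<open>- s\<close> of \<open>x y\<close> says that \<open>y\<close> has right trace \<open>0\<close>. If \<open>s\<close> were not zero, a shift of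
  \<open>x\<close> would make \<open>x y = - s x\<close>, and then the Jordan identity at \<open>u = y\<close> and \<open>u = x\<close>, together with
  the condition on the traces, leaves only the commutative algebra with \<open>x x = a x\<close>,
  \<open>x y = y x = - s x\<close>, \<open>y y = s y\<close>. That one is not Jordan: the identity at \<open>u = x + y\<close> and \<open>u = x - y\<close>, \<open>v = y\<close> forces \<open>s\<^sup>3 = 0\<close>.
\<close>

lemma jordan_kernel_vector_square_zero:
  assumes J: "jordan_algebra m" and sc: "structure_constants m x y a (-s) g 0 c p h s"
    and tr: "a + h = 1 \<or> a + h = 0 \<and> g = - s"
  shows "s = 0"
proof (rule ccontr)
  assume s: "s \<noteq> 0"
  have bil: "bilinear m" using J by (simp add: jordan_algebra_def)
  \<comment> \<open>replacing \<open>x\<close> by \<open>x + t y\<close> changes \<open>p\<close> into \<open>p + 2 t s\<close>\<close>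
  define t where "t = - p / (2 * s)"
  have t: "p + 2 * t * s = 0" using s by (simp add: t_def)
  define a' where "a' = a + t * - s + t * g"
  define c' where "c' = c + t * p + t * h + t * t * s - t * a'"
  define h' where "h' = h + t * s - t * g"
  have "structure_constants m (x + t *\<^sub>R y) y a' (- s) g 0 c' (p + t * s - t * - s) h' s"
    using structure_constants_shift[OF bil sc, of t] by (simp add: a'_def c'_def h'_def)
  moreover have "p + t * s - t * - s = 0" using t by (simp add: algebra_simps)
  ultimately have sc': "structure_constants m (x + t *\<^sub>R y) y a' (- s) g 0 c' 0 h' s"
    by simp
  note j = jordan_coordinates[OF J sc', unfolded bil_form_def]
  have tr': "a' + h' = 1 \<or> a' + h' = 0 \<and> g = - s"
    using tr by (simp add: a'_def h'_def)
  have "h' * s = 0"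
    using j(2)[where p=0 and q=1 and r=1 and s=0] by simp
  with s have h: "h' = 0" by simp
  have e: "c' * s * (s + s) = a' * (a' * (g + s))" "c' * (a' * (g + s)) = 0"
    using j[where p=1 and q=0 and r=0 and s=1] h by (simp_all add: algebra_simps)
  have g: "g = - s"
  proof (cases "a' = 0")
    case True
    with tr' h show ?thesis by simp
  next
    case a': False
    with e(2) have "c' = 0 \<or> g + s = 0" by simp
    with e(1) a' show ?thesis by auto
  qed
  with e(1) s have c: "c' = 0" by simp
  have "3 * s = a'"
    using j(1)[where p=1 and q=1 and r=0 and s=1] s unfolding h g c by simp
  moreover have "s * (s * (2 * s + a')) + s * (s * s) = 0"
    using j(1)[where p=1 and q="-1" and r=0 and s=1] unfolding h g c by simp
  ultimately have "s * (s * (2 * s + 3 * s)) + s * (s * s) = 0" by simp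
  then have "s * (s * s) = 0" by (simp add: algebra_simps)
  with s show False by simp
qed

text \<open>
  In the Jordan identity at \<open>u = \<xi> x + y\<close>, \<open>v = y\<close>, the term of first order in \<open>\<xi>\<close> is a multiple of
  \<open>g\<^sup>3\<close>. Hence \<open>g = 0\<close>, and \<open>y\<close> spans a two-sided ideal. The other two equations
  come from \<open>v = x\<close> with \<open>u = x\<close> and \<open>u = x + y\<close>. Geometrically the last one is a line and a conic in
  the \<open>(a, p)\<close>-plane once \<open>a + h\<close> is fixed.
\<close>

lemma jordan_kernel_vector_ideal:
  assumes J: "jordan_algebra m" and sc: "structure_constants m x y a 0 g 0 c p h 0"
  shows "g = 0" and "c * (a * h - p * p) = 0" and "(p + h - a) * (a * h - p * p) = 0"
proof -
  note j = jordan_coordinates[OF J sc, unfolded bil_form_def]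
  have e: "g * x * ((x * a + g) * (x * (p - a) - g)) = 0" for x
    using j(1)[where p=x and q=1 and r=0 and s=1] by (simp add: algebra_simps)
  show g: "g = 0"
  proof (rule ccontr)
    assume "g \<noteq> 0"
    then have "(x * a + g) * (x * (p - a) - g) = 0" if "x \<noteq> 0" for x
      using e[of x] that by simp
    from this[of 1] this[of "-1"] this[of 2]
    have "(a + g) * (p - a - g) = 0" "(g - a) * (a - p - g) = 0" "(2 * a + g) * (2 * (p - a) - g) = 0"
      by (simp_all add: add.commute)
    then have "3 * (g * g) = 0" by algebra
    with \<open>g \<noteq> 0\<close> show False by simp
  qed
  show c: "c * (a * h - p * p) = 0"
    using j(2)[where p=1 and q=0 and r=1 and s=0] g by (simp add: algebra_simps)
  have "(c + (p + h - a)) * (a * h - p * p) = 0"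
    using j(2)[where p=1 and q=1 and r=1 and s=0] g by (simp add: algebra_simps)
  with c show "(p + h - a) * (a * h - p * p) = 0" by algebra
qed

section \<open>Existence: reduction to the list\<close>

text \<open>
  A base change that takes a nonzero functional with values \<open>t1\<close>, \<open>t2\<close> to one with values \<open>1\<close>, \<open>0\<close>:
  the vector \<open>(t1, t2)\<close> divided by its squared length, and that vector turned by a right angle.
\<close>

lemma functional_adapted_basis:
  fixes t1 t2 :: real
  assumes "t1 \<noteq> 0 \<or> t2 \<noteq> 0"
  obtains p q r s :: real where "p * s - q * r \<noteq> 0" "p * t1 + q * t2 = 1" "r * t1 + s * t2 = 0"
proof -
  have "t1 * t1 + t2 * t2 \<noteq> 0" using assms by (simp add: sum_squares_eq_zero_iff)
  then show thesis
    by (intro that[of "t1 / (t1 * t1 + t2 * t2)" t1 "t2 / (t1 * t1 + t2 * t2)" "- t2"])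
       (simp_all add: add_divide_distrib[symmetric])
qed

text \<open>
  In a basis adapted to a trace, \<open>y\<close> lies in the kernel of the trace and \<open>x\<close> has trace \<open>1\<close>. The second
  disjunct describes algebras without right trace, where the basis is adapted to the left trace or is
  arbitrary because that one vanishes as well.
\<close>

lemma trace_adapted_basis:
  fixes m :: "'a::real_vector \<Rightarrow> 'a \<Rightarrow> 'a"
  assumes dim: "dim (UNIV :: 'a set) = 2" and bil: "bilinear m"
  obtains x y a g r c p h s where "structure_constants m x y a (- s) g r c p h s"
    and "a + h = 1 \<or> a + h = 0 \<and> g = - s \<and> (a + p = 1 \<or> a + p = 0)"
proof -
  obtain x y :: 'a where b: "basis_pair x y" using basis_pair_exists[OF dim] by blast
  obtain a1 a2 a3 a4 b1 b2 b3 b4 where sc: "structure_constants m x y a1 a2 a3 a4 b1 b2 b3 b4"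
    using structure_constants_exist[OF b] by blast
  show thesis
  proof (cases "a1 + b3 = 0 \<and> a2 + b4 = 0")
    case False
    then have "a1 + b3 \<noteq> 0 \<or> a2 + b4 \<noteq> 0" by simp
    from functional_adapted_basis[OF this] obtain p q r s where
      n: "p * s - q * r \<noteq> 0" "p * (a1 + b3) + q * (a2 + b4) = 1" "r * (a1 + b3) + s * (a2 + b4) = 0" .
    obtain c1 c2 c3 c4 d1 d2 d3 d4 where
      sc': "structure_constants m (p *\<^sub>R x + q *\<^sub>R y) (r *\<^sub>R x + s *\<^sub>R y) c1 c2 c3 c4 d1 d2 d3 d4"
      using structure_constants_exist[OF basis_pair_change[OF b n(1)]] by blast
    have tr: "c1 + d3 = 1" "c2 = - d4"
      using right_trace_change[OF bil sc sc' n(1)] n by simp_all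
    show thesis
      using sc' tr by (intro that[of "p *\<^sub>R x + q *\<^sub>R y" "r *\<^sub>R x + s *\<^sub>R y" c1 d4 c3 c4 d1 d2 d3]) simp_all
  next
    case R: True
    show thesis
    proof (cases "a1 + b2 = 0 \<and> a3 + b4 = 0")
      case False
      then have "a1 + b2 \<noteq> 0 \<or> a3 + b4 \<noteq> 0" by simp
      from functional_adapted_basis[OF this] obtain p q r s where
        n: "p * s - q * r \<noteq> 0" "p * (a1 + b2) + q * (a3 + b4) = 1" "r * (a1 + b2) + s * (a3 + b4) = 0" .
      obtain c1 c2 c3 c4 d1 d2 d3 d4 where
        sc': "structure_constants m (p *\<^sub>R x + q *\<^sub>R y) (r *\<^sub>R x + s *\<^sub>R y) c1 c2 c3 c4 d1 d2 d3 d4"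
        using structure_constants_exist[OF basis_pair_change[OF b n(1)]] by blast
      have tr: "c1 + d3 = 0" "c2 = - d4"
        using right_trace_change[OF bil sc sc' n(1)] R by simp_all
      have tl: "c1 + d2 = 1" "c3 = - d4"
        using left_trace_change[OF bil sc sc' n(1)] n by simp_all
      show thesis
        using sc' tr tl by (intro that[of "p *\<^sub>R x + q *\<^sub>R y" "r *\<^sub>R x + s *\<^sub>R y" c1 d4 c3 c4 d1 d2 d3]) simp_all
    next
      case True
      then have v: "a2 = - b4" "a3 = - b4" using R by simp_all
      show thesis
        by (rule that[OF sc[unfolded v]]) (use R True in simp)
    qed
  qed
qed

lemma vector_4_nth:
  "(vector [a, b, c, d] :: real^4) $ 1 = a" "(vector [a, b, c, d] :: real^4) $ 2 = b"
  "(vector [a, b, c, d] :: real^4) $ 3 = c" "(vector [a, b, c, d] :: real^4) $ 4 = d"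
  by (simp_all add: vector_def)

definition in_jordan_list :: "('a::real_vector \<Rightarrow> 'a \<Rightarrow> 'a) \<Rightarrow> bool" where
  "in_jordan_list m \<longleftrightarrow> (\<exists>j. admissible j \<and> has_structure_matrix m (jordan_matrix j))"

lemma in_jordan_listI:
  assumes "structure_constants m x y a1 a2 a3 a4 b1 b2 b3 b4" "admissible j"
    "jordan_matrix j = vector [vector [a1, a2, a3, a4], vector [b1, b2, b3, b4]]"
  shows "in_jordan_list m"
  unfolding in_jordan_list_def has_structure_matrix_def
  using assms by (intro exI[of _ j] conjI exI[of _ x] exI[of _ y]) (simp_all add: vector_4_nth)

lemma nilpotent_normal_form:
  assumes "bilinear m" "structure_constants m x y 0 0 0 0 c 0 0 0" "c \<noteq> 0"
  shows "in_jordan_list m"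
  using structure_constants_scale[OF assms]
  by (intro in_jordan_listI[of m _ _ _ _ _ _ _ _ _ _ J11]) (use assms(3) in simp_all)

text \<open>
  Scaling \<open>y\<close> multiplies \<open>r\<close> by a positive square, so over the reals the sign of \<open>r\<close> survives; this is
  why, with two possible values of \<open>p\<close>, there are four algebras of this kind.
\<close>

lemma transversal_normal_form:
  assumes bil: "bilinear m" and sc: "structure_constants m x y (1/2) 0 0 r 0 p (1/2) 0"
    and p: "p = 1/2 \<or> p = - (1/2)" and r: "r \<noteq> 0"
  shows "in_jordan_list m"
proof -
  define d where "d = 1 / sqrt \<bar>r\<bar>"
  have d: "d \<noteq> 0" using r by (simp add: d_def)
  have dr: "d * d * r = sgn r" using r by (simp add: d_def sgn_if)
  have sc': "structure_constants m x (d *\<^sub>R y) (1/2) 0 0 (sgn r) 0 p (1/2) 0"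
    using structure_constants_scale[OF bil sc d] dr by simp
  show ?thesis
    using p
  proof
    assume "p = 1/2"
    from sc'[unfolded this] show ?thesis
      by (rule in_jordan_listI[where j="if r > 0 then J1 else J3"]) (use r in \<open>simp_all add: sgn_if\<close>)
  next
    assume "p = - (1/2)"
    from sc'[unfolded this] show ?thesis
      by (rule in_jordan_listI[where j="if r > 0 then J2 else J4"]) (use r in \<open>simp_all add: sgn_if\<close>)
  qed
qed

text \<open>
  The exceptional parameters are the abscissas of the two points that the line \<open>p = 2 a - 1\<close> shares
  with the circle \<open>p\<^sup>2 = a (1 - a)\<close>. There the families \<open>J5\<close> and \<open>J6\<close> or \<open>J7\<close> would overlap.
\<close>

lemma exceptional_parameter_iff:
  fixes a :: real
  shows "(2 * a - 1) * (2 * a - 1) = a * (1 - a) \<longleftrightarrow>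
    a = 1/10 * (5 + sqrt 5) \<or> a = 1/10 * (5 - sqrt 5)"
proof -
  have "(2 * a - 1) * (2 * a - 1) - a * (1 - a) =
      5 * ((a - 1/10 * (5 + sqrt 5)) * (a - 1/10 * (5 - sqrt 5)))"
    by (simp add: algebra_simps)
  then show ?thesis by (metis eq_iff_diff_eq_0 mult_eq_0_iff zero_neq_numeral)
qed

lemma sqrt_branch_normal_form:
  assumes sc: "structure_constants m x y a 0 0 0 0 p (1 - a) 0" and p: "a * (1 - a) = p * p"
  shows "in_jordan_list m"
proof -
  have eq: "a - a\<^sup>2 = p\<^sup>2" using p by (simp add: power2_eq_square algebra_simps)
  have "0 \<le> a * (1 - a)" using p by simp
  then have a: "0 \<le> a" "a \<le> 1" by (auto simp: zero_le_mult_iff)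
  show ?thesis
  proof (cases "0 \<le> p")
    case True
    then show ?thesis using a by (intro in_jordan_listI[OF sc, of "J6 a"]) (simp_all add: eq)
  next
    case False
    then have "a \<noteq> 0" "a \<noteq> 1" using p by auto
    with False a show ?thesis by (intro in_jordan_listI[OF sc, of "J7 a"]) (simp_all add: eq)
  qed
qed

text \<open>
  Let \<open>a + h = 1\<close>. Away from the circle \<open>c\<close> vanishes and \<open>(a, p)\<close> lies on the line. On the circle a shift \<open>x + t y\<close> adds
  \<open>t (p + h - a)\<close> to \<open>c\<close>, so \<open>c\<close> can be removed unless the line passes through the same point; there \<open>c\<close>
  can only be scaled, to \<open>1\<close> if it is not \<open>0\<close>. For \<open>a + h = 0\<close> the conic \<open>a h = p\<^sup>2\<close> shrinks to the
  origin, over the reals.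
\<close>

lemma triangular_normal_form:
  assumes J: "jordan_algebra m" and sc: "structure_constants m x y a 0 0 0 c p h 0"
    and tr: "a + h = 1 \<or> a + h = 0 \<and> (a + p = 1 \<or> a + p = 0)"
    and nz: "a \<noteq> 0 \<or> c \<noteq> 0 \<or> p \<noteq> 0 \<or> h \<noteq> 0"
  shows "in_jordan_list m"
proof -
  have bil: "bilinear m" using J by (simp add: jordan_algebra_def)
  note j = jordan_kernel_vector_ideal(2,3)[OF J sc]
  show ?thesis
  proof (cases "a * h = p * p")
    case False
    with j have c: "c = 0" and p: "p = a - h" by auto
    from tr show ?thesis
    proof (elim disjE conjE)
      assume "a + h = 1"
      then have h: "h = 1 - a" by simp
      with p have p': "p = 2 * a - 1" by simp
      have "a * (1 - a) \<noteq> (2 * a - 1) * (2 * a - 1)" using False h p' by simp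
      then have "admissible (J5 a)" using exceptional_parameter_iff[of a] by auto
      with sc show ?thesis by (rule in_jordan_listI) (simp add: c h p')
    next
      assume "a + h = 0" "a + p = 1"
      with p have v: "a = 1/3" "h = - (1/3)" "p = 2/3" by simp_all
      show ?thesis by (rule in_jordan_listI[OF sc[unfolded c v], of J10]) simp_all
    next
      assume "a + h = 0" "a + p = 0"
      with p have "a = 0" "h = 0" "p = 0" by simp_all
      with False show ?thesis by simp
    qed
  next
    case eq: True
    show ?thesis
    proof (cases "a + h = 1")
      case True
      then have h: "h = 1 - a" by simp
      have eq': "a * (1 - a) = p * p" using eq h by simp
      show ?thesis
      proof (cases "p + h = a")
        case False
        \<comment> \<open>the zero of \<open>c + t (p + h - a)\<close>\<close>
        define t where "t = c / (a - p - h)"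
        have t: "c + t * p + t * h - t * a = 0"
        proof -
          have "t * (a - p - h) = c" using False by (simp add: t_def)
          then show ?thesis by (simp add: algebra_simps)
        qed
        have "structure_constants m (x + t *\<^sub>R y) y a 0 0 0 0 p h 0"
          using structure_constants_shift[OF bil sc, of t] t by simp
        then show ?thesis using eq' unfolding h by (rule sqrt_branch_normal_form)
      next
        case p: True
        show ?thesis
        proof (cases "c = 0")
          case True
          with sc have "structure_constants m x y a 0 0 0 0 p (1 - a) 0" by (simp add: h)
          then show ?thesis using eq' by (rule sqrt_branch_normal_form)
        next
          case c: False
          have p': "p = 2 * a - 1" using p h by simp
          have sc': "structure_constants m x (c *\<^sub>R y) a 0 0 0 1 p h 0"
            using structure_constants_scale[OF bil sc c] c by simp
          have "a = 1/10 * (5 + sqrt 5) \<or> a = 1/10 * (5 - sqrt 5)"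
            using eq' exceptional_parameter_iff[of a] by (simp add: p')
          then show ?thesis
          proof
            assume a: "a = 1/10 * (5 + sqrt 5)"
            show ?thesis
              by (rule in_jordan_listI[OF sc', of J9]) (simp_all add: h p' a field_simps)
          next
            assume a: "a = 1/10 * (5 - sqrt 5)"
            show ?thesis
              by (rule in_jordan_listI[OF sc', of J8]) (simp_all add: h p' a field_simps)
          qed
        qed
      qed
    next
      case False
      with tr have h: "h = - a" by simp
      have "a * a + p * p = 0" using eq unfolding h mult_minus_right by linarith
      then have "a = 0 \<and> p = 0" by (rule iffD1[OF sum_squares_eq_zero_iff])
      with h have z: "a = 0" "p = 0" "h = 0" by simp_all
      with nz have "c \<noteq> 0" by simp
      with sc z show ?thesis using nilpotent_normal_form[OF bil] by simp
    qed
  qed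
qed

lemma jordan_algebra_in_list:
  fixes m :: "'a::real_vector \<Rightarrow> 'a \<Rightarrow> 'a"
  assumes dim: "dim (UNIV :: 'a set) = 2" and J: "jordan_algebra m" and nt: "nontrivial_algebra m"
  shows "in_jordan_list m"
proof -
  have bil: "bilinear m" using J by (simp add: jordan_algebra_def)
  obtain x y a g r c p h s where sc: "structure_constants m x y a (- s) g r c p h s"
    and tr: "a + h = 1 \<or> a + h = 0 \<and> g = - s \<and> (a + p = 1 \<or> a + p = 0)"
    using trace_adapted_basis[OF dim bil] .
  show ?thesis
  proof (cases "r = 0")
    case False
    \<comment> \<open>the shift \<open>x + t y\<close> changes the coefficient \<open>- s\<close> of \<open>x y\<close> into \<open>- s + t r\<close>\<close>
    define t where "t = s / r"
    have t: "t * r = s" using False by (simp add: t_def)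
    define a' where "a' = a - t * s + t * g + t * s"
    define c' where "c' = c + t * p + t * h + t * t * s - t * a'"
    define p' where "p' = p + t * s"
    define h' where "h' = h + t * s - t * (g + s)"
    have t2: "t * t * r = t * s" using t by simp
    have sc': "structure_constants m (x + t *\<^sub>R y) y a' 0 (g + s) r c' p' h' 0"
      using structure_constants_shift[OF bil sc, of t] t by (simp add: t2 a'_def c'_def p'_def h'_def)
    note j = jordan_square_transversal[OF J sc' False]
    have tr': "a' + h' = a + h" by (simp add: a'_def h'_def algebra_simps)
    have g: "g + s = 0" using tr j(3) tr' by auto
    have c: "c' = 0" and a: "a' = h'" using j(1,2) g False by simp_all
    have p: "(h' - p') * (h' + p') = 0" using j(4) g by simp
    show ?thesis
    proof (cases "a + h = 1")
      case True
      then have h: "a' = 1/2" "h' = 1/2" using a tr' by simp_all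
      have "p' = 1/2 \<or> p' = - (1/2)" using p h by auto
      with sc' False show ?thesis
        using transversal_normal_form[OF bil] by (simp add: g c h)
    next
      case F: False
      then have h: "a' = 0" "h' = 0" using a tr tr' by simp_all
      then have p0: "p' = 0" using p by simp
      have "structure_constants m y (x + t *\<^sub>R y) 0 0 0 0 r 0 0 0"
        using structure_constants_swap[OF bil sc'] by (simp add: g c h p0)
      then show ?thesis using nilpotent_normal_form[OF bil] False by simp
    qed
  next
    case r: True
    have s: "s = 0"
      using jordan_kernel_vector_square_zero[OF J] sc tr r by blast
    have g: "g = 0"
      using jordan_kernel_vector_ideal(1)[OF J] sc r s by simp
    have sc': "structure_constants m x y a 0 0 0 c p h 0" using sc r s g by simp
    have "a \<noteq> 0 \<or> c \<noteq> 0 \<or> p \<noteq> 0 \<or> h \<noteq> 0"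
    proof (rule ccontr)
      assume "\<not> ?thesis"
      then have sc0: "structure_constants m x y 0 0 0 0 0 0 0 0" using sc' by simp
      have "m u v = 0" for u v
      proof -
        obtain u1 u2 v1 v2 where "u = u1 *\<^sub>R x + u2 *\<^sub>R y" "v = v1 *\<^sub>R x + v2 *\<^sub>R y"
          using sc0 unfolding structure_constants_def basis_pair_def by metis
        then show ?thesis using structure_constants_mult[OF bil sc0] by (simp add: bil_form_def)
      qed
      with nt show False by (simp add: nontrivial_algebra_def)
    qed
    then show ?thesis using triangular_normal_form[OF J sc'] tr by blast
  qed
qed

section \<open>Uniqueness: recovering the label\<close>

text \<open>
  The shape of both tables says that \<open>y\<close> and \<open>y'\<close> have right trace \<open>0\<close> while \<open>x\<close> and \<open>x'\<close> have right trace \<open>1\<close>.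
  Hence \<open>x' = x + q y\<close> and \<open>y' = d y\<close>, and comparing products gives the invariants. Passing from
  \<open>x\<close> to \<open>x + q y\<close> adds \<open>q (p + (1 - a) - a)\<close> to \<open>c\<close>, which is why the vanishing of \<open>c\<close> is an invariant
  only if \<open>p + (1 - a) = a\<close>.
\<close>

lemma trace_normalised_invariants:
  assumes bil: "bilinear m" and sc: "structure_constants m x y a 0 0 r c p (1 - a) 0"
    and sc': "structure_constants m x' y' a' 0 0 r' c' p' (1 - a') 0"
  shows "a = a'" and "p = p'" and "sgn r = sgn r'"
    and "p + (1 - a) = a \<Longrightarrow> c = 0 \<longleftrightarrow> c' = 0"
proof -
  have "basis_pair x y" "basis_pair x' y'"
    using sc sc' by (simp_all add: structure_constants_def)
  then obtain k q l d where x': "x' = k *\<^sub>R x + q *\<^sub>R y" and y': "y' = l *\<^sub>R x + d *\<^sub>R y"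
    and det: "k * d - q * l \<noteq> 0"
    using basis_pair_coordinates by metis
  note sc'' = sc'[unfolded x' y']
  have k: "k = 1" and l: "l = 0"
    using right_trace_change[OF bil sc sc'' det] by simp_all
  have d: "d \<noteq> 0" using det by (simp add: k l)
  note e = sc''[unfolded structure_constants_change_iff[OF bil sc det], unfolded bil_form_def k l]
  have e': "a + r * (q * q) = a'" "c + p * q + (1 - a) * q = a' * q + c' * d"
    "r * (q * d) = 0" "p * d = p' * d" "r * (d * d) = r'"
    using e by auto
  have rq: "r * q = 0" using e'(3) d by simp
  then have "r * (q * q) = 0" by simp
  then show a: "a = a'" using e'(1) by linarith
  show p: "p = p'" using e'(4) d by simp
  show "sgn r = sgn r'" using e'(5)[symmetric] d by (simp add: sgn_mult)
  show "c = 0 \<longleftrightarrow> c' = 0" if "p + (1 - a) = a"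
  proof -
    have "p * q + (1 - a) * q = (p + (1 - a)) * q" by (rule distrib_right[symmetric])
    also have "\<dots> = a * q" by (simp only: that)
    finally have "p * q + (1 - a) * q = a * q" .
    then have "c = c' * d" using e'(2) a by simp
    then show ?thesis using d by simp
  qed
qed

lemma jordan_matrix_zero_entries:
  "jordan_matrix j $1$2 = 0" "jordan_matrix j $1$3 = 0" "jordan_matrix j $2$4 = 0"
  by (cases j; simp add: vector_4_nth)+

lemma jordan_matrix_right_trace:
  "jordan_matrix j $1$1 + jordan_matrix j $2$3 = (if j = J10 \<or> j = J11 then 0 else 1)"
  by (cases j; simp add: vector_4_nth field_simps)

text \<open>
  A left inverse to the list on \<open>J1\<close> to \<open>J9\<close>. Here \<open>\<epsilon>\<close> is the sign of the coefficient \<open>r\<close> of \<open>y y\<close>, and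
  \<open>splits\<close> says that the line of \<open>y\<close> has a complement spanned by some \<open>x\<close> with \<open>x x\<close> a multiple of \<open>x\<close>.
  Reading off the label replaces a comparison of each pair of entries.
\<close>

definition label_of_invariants :: "real \<Rightarrow> real \<Rightarrow> real \<Rightarrow> bool \<Rightarrow> jordan_label" where
  "label_of_invariants a p \<epsilon> splits =
     (if \<epsilon> = 1 then if 0 < p then J1 else J2
      else if \<epsilon> = - 1 then if 0 < p then J3 else J4
      else if \<not> splits then if 0 < p then J9 else J8
      else if p * p \<noteq> a * (1 - a) then J5 a
      else if 0 \<le> p then J6 a else J7 a)"

lemma label_of_invariants_jordan_matrix:
  assumes "admissible j" "j \<noteq> J10" "j \<noteq> J11"
  shows "j = label_of_invariants (jordan_matrix j $1$1) (jordan_matrix j $2$2)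
    (sgn (jordan_matrix j $1$4))
    (jordan_matrix j $2$2 + (1 - jordan_matrix j $1$1) = jordan_matrix j $1$1 \<longrightarrow> jordan_matrix j $2$1 = 0)"
proof -
  have sq: "sqrt (b - b\<^sup>2) * sqrt (b - b\<^sup>2) = b * (1 - b)" "0 \<le> sqrt (b - b\<^sup>2)"
    if "0 \<le> b" "b \<le> 1" for b :: real
  proof -
    have "0 \<le> b * (1 - b)" using that by simp
    moreover have "b * (1 - b) = b - b\<^sup>2" by (simp add: power2_eq_square algebra_simps)
    ultimately show "sqrt (b - b\<^sup>2) * sqrt (b - b\<^sup>2) = b * (1 - b)" "0 \<le> sqrt (b - b\<^sup>2)"
      by simp_all
  qed
  show ?thesis
  proof (cases j)
    case (J5 b)
    have "(2 * b - 1) * (2 * b - 1) \<noteq> b * (1 - b)"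
      using assms(1) unfolding J5 by (simp only: exceptional_parameter_iff) simp
    moreover have "- 1 + 2 * b = 2 * b - 1" by simp
    ultimately show ?thesis
      unfolding J5 jordan_matrix.simps vector_2_4 label_of_invariants_def by simp
  next
    case (J6 b)
    with assms(1) have b: "0 \<le> b" "b \<le> 1" by simp_all
    show ?thesis
      unfolding J6 jordan_matrix.simps vector_2_4 label_of_invariants_def sq(1)[OF b]
      using sq(2)[OF b] by simp
  next
    case (J7 b)
    with assms(1) have b: "0 < b" "b < 1" by simp_all
    then have "b * (1 - b) \<noteq> 0" by simp
    then have "sqrt (b - b\<^sup>2) \<noteq> 0" using sq(1)[of b] b by (metis less_imp_le mult_zero_left)
    then have "\<not> 0 \<le> - sqrt (b - b\<^sup>2)" using sq(2)[of b] b by linarith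
    moreover have "- sqrt (b - b\<^sup>2) * - sqrt (b - b\<^sup>2) = b * (1 - b)"
      using sq(1)[of b] b by simp
    ultimately show ?thesis
      unfolding J7 jordan_matrix.simps vector_2_4 label_of_invariants_def by simp
  next
    case J8
    have "\<not> 0 < - (sqrt 5 / 5)"
      "- (sqrt 5 / 5) + (1 - 1/10 * (5 - sqrt 5)) = 1/10 * (5 - sqrt 5)"
      by (simp_all add: field_simps)
    then show ?thesis
      unfolding J8 jordan_matrix.simps vector_2_4 label_of_invariants_def by simp
  next
    case J9
    have "0 < sqrt 5 / 5"
      "sqrt 5 / 5 + (1 - 1/10 * (5 + sqrt 5)) = 1/10 * (5 + sqrt 5)"
      by (simp_all add: field_simps)
    then show ?thesis
      unfolding J9 jordan_matrix.simps vector_2_4 label_of_invariants_def by simp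
  qed (use assms(2,3) in \<open>simp_all add: vector_4_nth label_of_invariants_def\<close>)
qed

theorem theorem4p2:
  fixes m :: "'a::real_vector \<Rightarrow> 'a \<Rightarrow> 'a"
  assumes "dim (UNIV :: 'a set) = 2"
    and "jordan_algebra m"
    and "nontrivial_algebra m"
  shows "\<exists>!j. admissible j \<and> isomorphic_algebras m (algebra_of_matrix (jordan_matrix j))"
proof -
  have bil: "bilinear m" using assms(2) by (simp add: jordan_algebra_def)
  have unique: "j = j'"
    if adm: "admissible j" "admissible j'"
      and M: "has_structure_matrix m (jordan_matrix j)" "has_structure_matrix m (jordan_matrix j')"
    for j j'
  proof -
    let ?A = "jordan_matrix j" and ?B = "jordan_matrix j'"
    obtain x y where sc: "structure_constants m x y (?A$1$1) 0 0 (?A$1$4) (?A$2$1) (?A$2$2) (?A$2$3) 0"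
      using M(1) by (auto simp: has_structure_matrix_def jordan_matrix_zero_entries)
    obtain x' y' where sc': "structure_constants m x' y' (?B$1$1) 0 0 (?B$1$4) (?B$2$1) (?B$2$2) (?B$2$3) 0"
      using M(2) by (auto simp: has_structure_matrix_def jordan_matrix_zero_entries)
    have "basis_pair x y" "basis_pair x' y'"
      using sc sc' by (simp_all add: structure_constants_def)
    then obtain p q r s where x': "x' = p *\<^sub>R x + q *\<^sub>R y" and y': "y' = r *\<^sub>R x + s *\<^sub>R y"
      and det: "p * s - q * r \<noteq> 0"
      using basis_pair_coordinates by metis
    note sc'' = sc'[unfolded x' y']
    have "?B$1$1 + ?B$2$3 = p * (?A$1$1 + ?A$2$3)" "0 = r * (?A$1$1 + ?A$2$3)"
      using right_trace_change[OF bil sc sc'' det] by simp_all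
    then have R: "j = J10 \<or> j = J11 \<longleftrightarrow> j' = J10 \<or> j' = J11"
      using det by (auto simp: jordan_matrix_right_trace split: if_splits)
    show "j = j'"
    proof (cases "j = J10 \<or> j = J11")
      case True
      have "?B$1$1 + ?B$2$2 = p * (?A$1$1 + ?A$2$2)" "0 = r * (?A$1$1 + ?A$2$2)"
        using left_trace_change[OF bil sc sc'' det] by simp_all
      with True R det show ?thesis by (auto simp: vector_4_nth)
    next
      case False
      then have t: "?A$2$3 = 1 - ?A$1$1" "?B$2$3 = 1 - ?B$1$1"
        using R jordan_matrix_right_trace[of j] jordan_matrix_right_trace[of j'] by simp_all
      note i = trace_normalised_invariants[OF bil sc[unfolded t] sc'[unfolded t]]
      have "j \<noteq> J10" "j \<noteq> J11" "j' \<noteq> J10" "j' \<noteq> J11" using False R by auto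
      note l = label_of_invariants_jordan_matrix[OF adm(1) this(1,2)]
        label_of_invariants_jordan_matrix[OF adm(2) this(3,4)]
      have "(?A$2$2 + (1 - ?A$1$1) = ?A$1$1 \<longrightarrow> ?A$2$1 = 0) \<longleftrightarrow>
          (?B$2$2 + (1 - ?B$1$1) = ?B$1$1 \<longrightarrow> ?B$2$1 = 0)"
        using i by metis
      then show ?thesis
        by (subst l(1), subst l(2)) (simp only: i(1-3))
    qed
  qed
  obtain j where "admissible j" "has_structure_matrix m (jordan_matrix j)"
    using jordan_algebra_in_list[OF assms] unfolding in_jordan_list_def by blast
  then show ?thesis
    unfolding isomorphic_algebras_iff_structure_matrix[OF bil] using unique by blast
qed

end
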